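(* Fix an integer $k\ge 2$. Let $\kappa(r)=\kappa(m,r,s,u)$ be the formal power series in $r$ satisfying $$\kappa(r)=1-rs(m-1)\prod_{j=0}^{k-1}\kappa(rs^{j})-rs(m(u-1)+1)\prod_{j=0}^{k}\kappa(rs^{j}).$$ Then $$\kappa(r)=\sum_{n\ge 0}(-rs)^{n}\sum_{\mu\in\mathtt{Dyck}(n;k)}s^{|Y(\mu_{0}/\mu)|}\,\mathrm{wt}^{III}(\mu).$$
   Context: $m,s,u$ are formal variables, $m'=m-1$, $u'=u-1$, and power series in $r$ have coefficients in $\mathbb{Z}[m,s,u]$. A $k$-Dyck path of size $n$ is a lattice path from $(0,0)$ to $(kn,n)$ consisting of up steps $U=(0,1)$ and down steps $D=(1,0)$ which never goes below the line $y=x/k$; $\mathtt{Dyck}(n;k)$ is the set of them. $\mu_0=(UD^k)^n$ is the lowest path, and $|Y(\mu_0/\mu)|$ is the number of unit boxes above $\mu_0$ and below $\mu$. $\mathrm{Peak}(\mu)$ is the number of occurrences of the pattern $UD$ (consecutive steps) in $\mu$. For $\mu\in\mathtt{Dyck}(n;k)$, $$\mathrm{wt}^{III}(\mu)=(m'+1)^{\mathrm{Peak}(\mu)}(u'+1)^{\mathrm{Peak}(\mu)}(m'u'+u'+1)^{n-\mathrm{Peak}(\mu)}.$$ *)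

theory Defs
  imports
    "HOL-Computational_Algebra.Polynomial"
    "HOL-Computational_Algebra.Formal_Power_Series"
begin

(* The coefficient ring Z[m,s,u], as the iterated polynomial ring Z[m][s][u]. *)
type_synonym coeff_ring = "int poly poly poly"

definition var_m :: coeff_ring where "var_m = [:[:[:0, 1:]:]:]"
definition var_s :: coeff_ring where "var_s = [:[:0, 1:]:]"
definition var_u :: coeff_ring where "var_u = [:0, 1:]"

definition subst_r :: "coeff_ring fps \<Rightarrow> coeff_ring \<Rightarrow> coeff_ring fps"
  where "subst_r f c = f oo (fps_X * fps_const c)"  (* f(r c), where r is fps_X *)

datatype step = U | D

type_synonym path = "step list"

(* After an initial segment q the path is at the lattice point
   (count_list q D, count_list q U).  As the steps are straight, a path stays weakly above
   the line y = x/k iff all of its lattice points do. *)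
definition Dyck :: "nat \<Rightarrow> nat \<Rightarrow> path set" where
  "Dyck n k = {p. count_list p U = n \<and> count_list p D = k * n \<and>
     (\<forall>q q'. p = q @ q' \<longrightarrow> count_list q D \<le> k * count_list q U)}"

definition lowest_path :: "nat \<Rightarrow> nat \<Rightarrow> path" where
  "lowest_path n k = concat (replicate n (U # replicate k D))"

(* The pair (i,j) stands for the unit box with lower left corner (i,j), that is, with
   corners (i,j) and (i+1,j+1).  The D step after q is the only step of the path crossing
   column i = count_list q D; it does so at height count_list q U. *)
definition boxes_below :: "path \<Rightarrow> (nat \<times> nat) set" where
  "boxes_below p = {(i, j). \<exists>q q'. p = q @ D # q' \<and> count_list q D = i \<and> j + 1 \<le> count_list q U}"

definition boxes_above :: "path \<Rightarrow> (nat \<times> nat) set" where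
  "boxes_above p = {(i, j). \<exists>q q'. p = q @ D # q' \<and> count_list q D = i \<and> count_list q U \<le> j}"

definition Y_boxes :: "path \<Rightarrow> path \<Rightarrow> (nat \<times> nat) set" where
  "Y_boxes p0 p = boxes_above p0 \<inter> boxes_below p"

definition Peak :: "path \<Rightarrow> nat" where
  "Peak p = card {i. i + 1 < length p \<and> p ! i = U \<and> p ! (i + 1) = D}"

(* For p in Dyck n k one has Peak p <= n, so the subtraction is not truncated. *)
definition wtIII :: "nat \<Rightarrow> path \<Rightarrow> coeff_ring" where
  "wtIII n p = (let m' = var_m - 1; u' = var_u - 1 in
     (m' + 1) ^ Peak p * (u' + 1) ^ Peak p * (m' * u' + u' + 1) ^ (n - Peak p))"

lemma finite_Dyck: "finite (Dyck n k)"
proof -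
  have len: "length p = count_list p U + count_list p D" for p :: path
  proof (induction p)
    case (Cons a p)
    then show ?case by (cases a) auto
  qed simp
  have U: "set p \<subseteq> {U, D}" for p :: path
    using step.exhaust by auto
  have "Dyck n k \<subseteq> {p. set p \<subseteq> {U, D} \<and> length p = n + k * n}"
    using len U by (auto simp: Dyck_def)
  then show ?thesis
    by (rule finite_subset) (simp add: finite_lists_length_eq)
qed

end

theory Submission imports Defs begin

text \<open>
  Grade the lattice paths by the level \<open>k * #U - #D\<close> of their end points. The number of boxes between
  a Dyck path and the lowest path is the sum of the levels at which the \<open>U\<close> steps start (count the
  boxes row by row). Hence the weighted sums \<open>H l\<close> over paths running from level \<open>l\<close> down to level
  \<open>0\<close> satisfy, on removal of the first step, with \<open>a = m - 1\<close> and \<open>b = m * (u - 1) + 1\<close>,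
  \<open>H l = H (l - 1) - r * s * s^l * (a * H (l + k - 1) + b * H (l + k))\<close>, where \<open>H (- 1)\<close> means \<open>1\<close>:
  a \<open>U\<close> step followed by \<open>D\<close> has weight \<open>m * u = a + b\<close> and any other one has weight \<open>b\<close>.
  The products of the \<open>\<kappa> (r * s^j)\<close> over \<open>j \<le> l\<close> satisfy the same recurrence, by the functional
  equation at \<open>r * s^l\<close>, and the recurrence has only one solution.
\<close>

section \<open>Paths descending to level zero\<close>

text \<open>Only a \<open>D\<close> step can bring the path below the line, so the guard
  \<open>l > 0\<close> encodes the boundary and keeps \<open>l - 1\<close> exact.\<close>

fun descends :: "nat \<Rightarrow> nat \<Rightarrow> path \<Rightarrow> bool" where
  "descends k l [] \<longleftrightarrow> l = 0"
| "descends k l (U # p) \<longleftrightarrow> descends k (l + k) p"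
| "descends k l (D # p) \<longleftrightarrow> l > 0 \<and> descends k (l - 1) p"

definition descents :: "nat \<Rightarrow> nat \<Rightarrow> nat \<Rightarrow> path set" where
  "descents k n l = {p. count_list p U = n \<and> descends k l p}"

lemma all_prefixes_Cons:
  "(\<forall>q q'. x # p = q @ q' \<longrightarrow> P q) \<longleftrightarrow> P [] \<and> (\<forall>q q'. p = q @ q' \<longrightarrow> P (x # q))"
  by (auto simp: Cons_eq_append_conv)

lemma descends_iff:
  "descends k l p \<longleftrightarrow> count_list p D = k * count_list p U + l \<and>
     (\<forall>q q'. p = q @ q' \<longrightarrow> count_list q D \<le> k * count_list q U + l)"
proof (induction k l p rule: descends.induct)
  case (2 k l p)
  then show ?case by (subst all_prefixes_Cons) (auto simp: algebra_simps)
next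
  case (3 k l p)
  show ?case
  proof (cases l)
    case 0
    \<comment> \<open>At level 0 the prefix \<open>[D]\<close> is already below the line.\<close>
    have "\<exists>q q'. D # p = q @ q' \<and> \<not> count_list q D \<le> k * count_list q U"
      by (rule exI[of _ "[D]"]) simp
    with 0 show ?thesis by auto
  next
    case (Suc l')
    with 3 show ?thesis by (subst all_prefixes_Cons) auto
  qed
qed auto

lemma Dyck_eq_descents: "Dyck n k = descents k n 0"
  by (auto simp: Dyck_def descents_def descends_iff)

lemma descents_rec:
  "descents k n l = (if n = 0 \<and> l = 0 then {[]} else {})
     \<union> (if n > 0 then (#) U ` descents k (n - 1) (l + k) else {})
     \<union> (if l > 0 then (#) D ` descents k n (l - 1) else {})" (is "_ = ?R")
proof (intro set_eqI)
  fix p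
  show "p \<in> descents k n l \<longleftrightarrow> p \<in> ?R"
  proof (cases p)
    case (Cons x q)
    then show ?thesis by (cases x) (auto simp: descents_def)
  qed (auto simp: descents_def)
qed

text \<open>Along \<open>descents_rec\<close> the pair (n, l) decreases lexicographically: a
  \<open>U\<close> step lowers n while raising l, and a \<open>D\<close> step lowers l
  alone.\<close>

lemma finite_descents: "finite (descents k n l)"
proof (induction n arbitrary: l)
  case 0
  show ?case by (induction l) (subst descents_rec; simp)+
next
  case (Suc n)
  show ?case by (induction l) (subst descents_rec; simp add: Suc.IH)+
qed

section \<open>The weight of a path\<close>

fun level_sum :: "nat \<Rightarrow> nat \<Rightarrow> path \<Rightarrow> nat" where
  "level_sum k l [] = 0"
| "level_sum k l (U # p) = l + level_sum k (l + k) p"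
| "level_sum k l (D # p) = level_sum k (l - 1) p"

lemma Peak_Nil [simp]: "Peak [] = 0"
  by (simp add: Peak_def)

lemma Peak_Cons:
  "Peak (x # p) = (if x = U \<and> p \<noteq> [] \<and> hd p = D then 1 else 0) + Peak p"
proof -
  let ?A = "\<lambda>p. {i. i + 1 < length p \<and> p ! i = U \<and> p ! (i + 1) = D}"
  have fin: "finite (?A p)"
    by (rule finite_subset[of _ "{..<length p}"]) auto
  have "?A (x # p) = (if x = U \<and> p \<noteq> [] \<and> hd p = D then {0} else {}) \<union> Suc ` ?A p" (is "?L = ?R")
  proof (intro set_eqI)
    fix i show "i \<in> ?L \<longleftrightarrow> i \<in> ?R"
      by (cases i; cases p) (auto simp: nth_Cons')
  qed
  with fin show ?thesis
    by (simp add: Peak_def card_image card_insert_if image_iff)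
qed

lemma Peak_le_count_U: "Peak p \<le> count_list p U"
  by (induction p) (auto simp: Peak_Cons)

definition path_wt :: "nat \<Rightarrow> 'a::comm_ring_1 \<Rightarrow> 'a \<Rightarrow> 'a \<Rightarrow> nat \<Rightarrow> path \<Rightarrow> 'a" where
  "path_wt k s a b l p = s ^ level_sum k l p * (a + b) ^ Peak p * b ^ (count_list p U - Peak p)"

lemma path_wt_Nil: "path_wt k s a b l [] = 1"
  by (simp add: path_wt_def)

lemma path_wt_D: "path_wt k s a b l (D # p) = path_wt k s a b (l - 1) p"
  by (simp add: path_wt_def Peak_Cons)

lemma path_wt_U:
  "path_wt k s a b l (U # p) =
     s ^ l * ((if p \<noteq> [] \<and> hd p = D then a else 0) + b) * path_wt k s a b (l + k) p"
  \<comment> \<open>This keeps the exponent of b untruncated, so a \<open>U\<close> that opens no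
    peak adds one factor b.\<close>
  using Peak_le_count_U[of p]
  by (simp add: path_wt_def Peak_Cons power_add Suc_diff_le algebra_simps)

section \<open>First-step recurrence for the weighted path sums\<close>

definition descent_sum :: "nat \<Rightarrow> 'a::comm_ring_1 \<Rightarrow> 'a \<Rightarrow> 'a \<Rightarrow> nat \<Rightarrow> nat \<Rightarrow> 'a" where
  "descent_sum k s a b n l = (\<Sum>p\<in>descents k n l. path_wt k s a b l p)"

lemma sum_D_descents:
  "(\<Sum>p\<in>(#) D ` descents k n l. path_wt k s a b (Suc l) p) = descent_sum k s a b n l"
  by (simp add: descent_sum_def sum.reindex path_wt_D)

text \<open>Every continuation contributes b, and those starting with \<open>D\<close> contribute a
  in addition. As k > 0, the level l + k is positive, and removing that \<open>D\<close> leaves all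
  paths from level l + k - 1.\<close>

lemma sum_U_descents:
  assumes "k > 0"
  shows "(\<Sum>p\<in>(#) U ` descents k n (l + k). path_wt k s a b l p) =
    s ^ l * (a * descent_sum k s a b n (l + k - 1) + b * descent_sum k s a b n (l + k))"
proof -
  let ?P = "descents k n (l + k)" and ?w = "path_wt k s a b (l + k)"
  have D: "{p \<in> ?P. p \<noteq> [] \<and> hd p = D} = (#) D ` descents k n (l + k - 1)"
    using assms by (subst descents_rec) auto
  have "(\<Sum>p\<in>(#) U ` ?P. path_wt k s a b l p) =
      (\<Sum>p\<in>?P. s ^ l * (a * (if p \<noteq> [] \<and> hd p = D then ?w p else 0) + b * ?w p))"
    by (simp add: sum.reindex path_wt_U algebra_simps) (rule sum.cong; simp add: algebra_simps)
  also have "\<dots> = s ^ l * (a * (\<Sum>p\<in>{p \<in> ?P. p \<noteq> [] \<and> hd p = D}. ?w p) + b * (\<Sum>p\<in>?P. ?w p))"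
    by (simp only: sum.inter_filter[OF finite_descents] sum_distrib_left sum.distrib distrib_left)
  finally show ?thesis
    unfolding D using assms sum_D_descents[of k s a b "l + k - 1" n] by (simp add: descent_sum_def)
qed

text \<open>At l = 0 no \<open>D\<close> step is possible; the empty path supplies the value 1 for n
  = 0, which is the convention \<open>H (- 1) = 1\<close>.\<close>

lemma descent_sum_rec:
  assumes "k > 0"
  shows "descent_sum k s a b n l =
    (if l = 0 then (if n = 0 then 1 else 0) else descent_sum k s a b n (l - 1)) +
    (if n = 0 then 0 else s ^ l *
       (a * descent_sum k s a b (n - 1) (l + k - 1) + b * descent_sum k s a b (n - 1) (l + k)))"
proof -
  let ?w = "path_wt k s a b l"
  let ?N = "if n = 0 \<and> l = 0 then {[]} else {}"
  let ?U = "if n > 0 then (#) U ` descents k (n - 1) (l + k) else {}"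
  let ?D = "if l > 0 then (#) D ` descents k n (l - 1) else {}"
  have "descent_sum k s a b n l = sum ?w (?N \<union> ?U \<union> ?D)"
    unfolding descent_sum_def by (subst descents_rec) simp
  also have "\<dots> = sum ?w (?N \<union> ?U) + sum ?w ?D"
    by (rule sum.union_disjoint) (auto simp: finite_descents)
  also have "sum ?w (?N \<union> ?U) = sum ?w ?N + sum ?w ?U"
    by (rule sum.union_disjoint) (auto simp: finite_descents)
  finally show ?thesis
    using sum_U_descents[OF assms, where n = "n - 1" and l = l and s = s and a = a and b = b]
      sum_D_descents[where n = n and l = "l - 1" and s = s and a = a and b = b and k = k]
    by (cases l) (auto simp: path_wt_Nil)
qed

section \<open>Counting the boxes by rows\<close>

text \<open>The path p is placed with its start at (x, y), so that induction on p is possible. The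
  condition \<open>i < k * j\<close> expresses that the box lies above the lowest path.\<close>

definition boxes_from :: "nat \<Rightarrow> nat \<Rightarrow> nat \<Rightarrow> path \<Rightarrow> (nat \<times> nat) set" where
  "boxes_from k x y p = {(i, j). \<exists>q q'. p = q @ D # q' \<and> i = x + count_list q D \<and>
     y \<le> j \<and> j + 1 \<le> y + count_list q U \<and> i < k * j}"

text \<open>The quantifiers stand in the miniscoped form that the simplifier produces.\<close>

lemma ex_split_Cons:
  "(\<exists>q. (\<exists>q'. x # p = q @ D # q') \<and> Q q) \<longleftrightarrow>
     x = D \<and> Q [] \<or> (\<exists>q. (\<exists>q'. p = q @ D # q') \<and> Q (x # q))"
  by (auto simp: Cons_eq_append_conv)

lemma ex_D_split: "(\<exists>q q'. p = q @ D # q' \<and> count_list q D = i) \<longleftrightarrow> i < count_list p D"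
proof (induction p arbitrary: i)
  case (Cons x p)
  then show ?case
    by (cases x; cases i) (simp_all add: ex_split_Cons)
qed simp

lemma boxes_from_Nil: "boxes_from k x y [] = {}"
  by (simp add: boxes_from_def)

lemma boxes_from_D: "boxes_from k x y (D # p) = boxes_from k (Suc x) y p"
  by (auto simp: boxes_from_def ex_split_Cons)

text \<open>The leading \<open>U\<close> opens row y, whose boxes above the lowest path end at
  column \<open>k * y\<close>; by the hypothesis the path crosses all columns from x up to
  there.\<close>

lemma boxes_from_U:
  assumes "k * y \<le> x + count_list p D"
  shows "boxes_from k x y (U # p) = boxes_from k x (Suc y) p \<union> {x..<k * y} \<times> {y}"
proof (intro set_eqI, clarify)
  fix i j
  show "(i, j) \<in> boxes_from k x y (U # p) \<longleftrightarrow>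
      (i, j) \<in> boxes_from k x (Suc y) p \<union> {x..<k * y} \<times> {y}"
  proof (cases "j = y")
    case True
    \<comment> \<open>In row y the height condition is automatic, since any split occurs after the
      leading \<open>U\<close>.\<close>
    have "(i, j) \<in> boxes_from k x y (U # p) \<longleftrightarrow>
        (\<exists>q q'. p = q @ D # q' \<and> i = x + count_list q D) \<and> i < k * y"
      unfolding boxes_from_def using True by (auto simp: ex_split_Cons)
    also have "(\<exists>q q'. p = q @ D # q' \<and> i = x + count_list q D) \<longleftrightarrow>
        x \<le> i \<and> (\<exists>q q'. p = q @ D # q' \<and> count_list q D = i - x)"
      by (metis add_diff_cancel_left' le_add1 le_add_diff_inverse)
    also have "\<dots> \<and> i < k * y \<longleftrightarrow> x \<le> i \<and> i < k * y"
      using assms ex_D_split[of p "i - x"] by auto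
    finally show ?thesis using True by (simp add: boxes_from_def)
  next
    case False
    then show ?thesis unfolding boxes_from_def by (auto simp: ex_split_Cons)
  qed
qed

text \<open>The invariant \<open>x + l = k * y\<close> says that (x, y) has level l, so a
  \<open>U\<close> step from there adds a row of \<open>k * y - x = l\<close> boxes.\<close>

lemma finite_card_boxes_from:
  assumes "descends k l p" "x + l = k * y"
  shows "finite (boxes_from k x y p) \<and> card (boxes_from k x y p) = level_sum k l p"
  using assms
proof (induction k l p arbitrary: x y rule: descends.induct)
  case (2 k l p)
  have "x + count_list p D = k * y + k * count_list p U + k"
    using 2 by (simp add: descends_iff)
  then have eq: "boxes_from k x y (U # p) = boxes_from k x (Suc y) p \<union> {x..<k * y} \<times> {y}"
    by (intro boxes_from_U) simp
  have IH: "finite (boxes_from k x (Suc y) p) \<and>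
      card (boxes_from k x (Suc y) p) = level_sum k (l + k) p"
    using 2 by (intro "2.IH") auto
  have "boxes_from k x (Suc y) p \<inter> {x..<k * y} \<times> {y} = {}"
    by (auto simp: boxes_from_def)
  with IH have "card (boxes_from k x y (U # p)) = level_sum k (l + k) p + (k * y - x)"
    unfolding eq by (subst card_Un_disjoint) auto
  moreover have "k * y - x = l" using 2 by simp
  ultimately show ?case using IH by (simp add: eq)
next
  case (3 k l p)
  then show ?case by (simp add: boxes_from_D)
qed (simp add: boxes_from_Nil)

section \<open>Boxes above the lowest path\<close>

lemma boxes_above_U: "(i, j) \<in> boxes_above (U # p) \<longleftrightarrow> j > 0 \<and> (i, j - 1) \<in> boxes_above p"
  by (cases j) (simp_all add: boxes_above_def ex_split_Cons)

lemma boxes_above_D: "(i, j) \<in> boxes_above (D # p) \<longleftrightarrow> i = 0 \<or> (i - 1, j) \<in> boxes_above p"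
  by (cases i) (simp_all add: boxes_above_def ex_split_Cons)

lemma boxes_above_replicate_D:
  "(i, j) \<in> boxes_above (replicate m D @ p) \<longleftrightarrow> i < m \<or> (i - m, j) \<in> boxes_above p"
proof (induction m arbitrary: i)
  case (Suc m)
  then show ?case by (cases i) (auto simp: boxes_above_D)
qed simp

text \<open>The lowest path crosses column i at height \<open>i div k + 1\<close>. The induction
  removes the first block, which shifts columns by k and rows by 1.\<close>

lemma boxes_above_lowest_path:
  "(i, j) \<in> boxes_above (lowest_path n k) \<longleftrightarrow> i < k * n \<and> i < k * j"
proof (induction n arbitrary: i j)
  case 0
  show ?case by (simp add: lowest_path_def boxes_above_def)
next
  case (Suc n)
  have "lowest_path (Suc n) k = U # replicate k D @ lowest_path n k"
    by (simp add: lowest_path_def)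
  then have "(i, j) \<in> boxes_above (lowest_path (Suc n) k) \<longleftrightarrow>
      j > 0 \<and> (i < k \<or> i - k < k * n \<and> i - k < k * (j - 1))"
    by (simp add: boxes_above_U boxes_above_replicate_D Suc.IH)
  also have "\<dots> \<longleftrightarrow> i < k * Suc n \<and> i < k * j"
    by (cases j) auto
  finally show ?case .
qed

lemma card_Y_boxes:
  assumes "\<mu> \<in> Dyck n k"
  shows "card (Y_boxes (lowest_path n k) \<mu>) = level_sum k 0 \<mu>"
proof -
  have \<mu>: "descends k 0 \<mu>" "count_list \<mu> D = k * n"
    using assms by (auto simp: Dyck_eq_descents descents_def descends_iff)
  have "i < k * n" if "\<mu> = q @ D # q'" "count_list q D = i" for i q q'
    using \<mu>(2) ex_D_split[of \<mu> i] that by auto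
  then have "Y_boxes (lowest_path n k) \<mu> = boxes_from k 0 0 \<mu>"
    by (auto simp: Y_boxes_def boxes_from_def boxes_below_def boxes_above_lowest_path)
  then show ?thesis
    using finite_card_boxes_from[OF \<mu>(1), of 0 0] by simp
qed

lemma Dyck_sum_eq_descent_sum:
  "(\<Sum>\<mu>\<in>Dyck n k. var_s ^ card (Y_boxes (lowest_path n k) \<mu>) * wtIII n \<mu>) =
    descent_sum k var_s (var_m - 1) (var_m * (var_u - 1) + 1) n 0"
  unfolding descent_sum_def Dyck_eq_descents[symmetric]
proof (rule sum.cong)
  fix \<mu> assume \<mu>: "\<mu> \<in> Dyck n k"
  \<comment> \<open>The non-peak factor of \<open>wtIII\<close> is b, and its peak factor is a +
    b.\<close>
  have "(var_m - 1) * (var_u - 1) + (var_u - 1) + 1 = var_m * (var_u - 1) + (1::coeff_ring)"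
    "(var_m - 1) + (var_m * (var_u - 1) + 1) = var_m * (var_u::coeff_ring)"
    by (simp_all add: algebra_simps)
  moreover have "count_list \<mu> U = n"
    using \<mu> by (simp add: Dyck_def)
  ultimately show "var_s ^ card (Y_boxes (lowest_path n k) \<mu>) * wtIII n \<mu> =
      path_wt k var_s (var_m - 1) (var_m * (var_u - 1) + 1) 0 \<mu>"
    by (simp only: card_Y_boxes[OF \<mu>] path_wt_def wtIII_def Let_def)
       (simp add: power_mult_distrib mult_ac)
qed simp

section \<open>Products of rescaled solutions\<close>

unbundle fps_syntax

lemma subst_r_nth: "subst_r f c $ n = c ^ n * f $ n"
  by (simp add: subst_r_def fps_compose_linear mult.commute[of fps_X])

lemma subst_r_subst_r: "subst_r (subst_r f c) d = subst_r f (c * d)"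
  by (simp add: fps_eq_iff subst_r_nth power_mult_distrib mult_ac)

lemma subst_r_mult: "subst_r (f * g) c = subst_r f c * subst_r g c"
  by (simp add: subst_r_def fps_compose_mult_distrib)

lemma subst_r_prod: "subst_r (prod f A) c = (\<Prod>x\<in>A. subst_r (f x) c)"
  by (simp add: subst_r_def fps_compose_prod_distrib)

lemma subst_r_diff: "subst_r (f - g) c = subst_r f c - subst_r g c"
  by (simp add: subst_r_def fps_compose_sub_distrib)

lemma subst_r_one: "subst_r 1 c = 1"
  by (simp add: subst_r_def)

lemma subst_r_const: "subst_r (fps_const a) c = fps_const a"
  by (simp add: subst_r_def)

lemma subst_r_X: "subst_r fps_X c = fps_const c * fps_X"
  by (auto simp: fps_eq_iff subst_r_nth fps_X_def)

lemmas subst_r_simps =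
  subst_r_mult subst_r_prod subst_r_diff subst_r_one subst_r_const subst_r_X subst_r_subst_r

text \<open>Multiply the functional equation, taken at \<open>r * s^l\<close>, by
  \<open>K l\<close>: the rescaled products then continue \<open>K l\<close> without a gap.\<close>

lemma rescaled_product_rec:
  fixes \<kappa> :: "coeff_ring fps" and s a b :: coeff_ring
  defines "K \<equiv> \<lambda>l. \<Prod>j<l. subst_r \<kappa> (s ^ j)"
  assumes "\<kappa> = 1 - fps_X * fps_const s * fps_const a * K k - fps_X * fps_const s * fps_const b * K (Suc k)"
  shows "K (Suc l) = K l -
    fps_X * fps_const (s * s ^ l) * (fps_const a * K (l + k) + fps_const b * K (Suc (l + k)))"
proof -
  have shift: "K l * subst_r (K i) (s ^ l) = K (l + i)" for i
  proof (induction i)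
    case (Suc i)
    have "K l * subst_r (K (Suc i)) (s ^ l) = (K l * subst_r (K i) (s ^ l)) * subst_r \<kappa> (s ^ (l + i))"
      by (simp add: K_def subst_r_simps power_add mult_ac)
    with Suc show ?case by (simp add: K_def)
  qed (simp add: K_def subst_r_simps)
  let ?t = "fps_X * fps_const (s * s ^ l)"
  have eq: "subst_r \<kappa> (s ^ l) = 1 - ?t * fps_const a * subst_r (K k) (s ^ l)
      - ?t * fps_const b * subst_r (K (Suc k)) (s ^ l)"
    by (subst assms(2)) (simp only: subst_r_mult subst_r_diff subst_r_one subst_r_const subst_r_X
        fps_const_mult[symmetric] mult_ac)
  have "K (Suc l) = K l * subst_r \<kappa> (s ^ l)"
    by (simp add: K_def)
  also have "\<dots> = K l - ?t * (fps_const a * (K l * subst_r (K k) (s ^ l))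
      + fps_const b * (K l * subst_r (K (Suc k)) (s ^ l)))"
    unfolding eq by (simp only: algebra_simps mult_1_left mult_1_right)
  finally show ?thesis by (simp only: shift add_Suc_right)
qed

text \<open>Level l corresponds to l + 1 factors, and \<open>K 0 = 1\<close> to level -1. Both sides
  obey one recurrence, solved by induction on n (the factor r lowers it) and, inside, on l.\<close>

lemma nth_rescaled_product:
  fixes \<kappa> :: "coeff_ring fps" and s a b :: coeff_ring
  defines "K \<equiv> \<lambda>l. \<Prod>j<l. subst_r \<kappa> (s ^ j)"
  assumes "k > 0"
    and \<kappa>: "\<kappa> = 1 - fps_X * fps_const s * fps_const a * K k - fps_X * fps_const s * fps_const b * K (Suc k)"
  shows "K (Suc l) $ n = (- s) ^ n * descent_sum k s a b n l"
proof -
  have rec: "K (Suc l) $ n = K l $ n - (if n = 0 then 0 else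
      s * s ^ l * (a * K (l + k) $ (n - 1) + b * K (Suc (l + k)) $ (n - 1)))" for l n
  proof -
    have "K (Suc l) = K l -
        fps_X * fps_const (s * s ^ l) * (fps_const a * K (l + k) + fps_const b * K (Suc (l + k)))"
      unfolding K_def by (rule rescaled_product_rec[OF \<kappa>[unfolded K_def]])
    then show ?thesis
      by (simp add: mult.assoc distrib_left)
  qed
  have K0: "K 0 $ n = (if n = 0 then 1 else 0)" for n
    by (simp add: K_def)
  show ?thesis
  proof (induction n arbitrary: l)
    case 0
    show ?case
      by (induction l) (simp_all add: rec[of _ 0] K0 descent_sum_rec[OF \<open>k > 0\<close>, of _ _ _ 0])
  next
    case (Suc n)
    \<comment> \<open>This exhibits \<open>K (l + k)\<close> as \<open>K (Suc (l + k - 1))\<close>,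
      to which the induction hypothesis applies.\<close>
    obtain k' where k': "k = Suc k'" using \<open>k > 0\<close> by (cases k) auto
    have step: "K (Suc l) $ Suc n = K l $ Suc n + (- s) ^ Suc n * (s ^ l *
        (a * descent_sum k s a b n (l + k - 1) + b * descent_sum k s a b n (l + k)))" for l
      using Suc.IH[of "l + k - 1"] Suc.IH[of "l + k"]
      by (subst rec) (simp add: k' algebra_simps)
    show ?case
      by (induction l)
         (simp_all add: step K0 descent_sum_rec[OF \<open>k > 0\<close>, of _ _ _ "Suc n"] distrib_left)
  qed
qed

theorem proposition4p30:
  fixes k :: nat and \<kappa> :: "coeff_ring fps"
  assumes "k \<ge> 2"
    and "\<kappa> = 1
      - fps_X * fps_const var_s * fps_const (var_m - 1)
          * (\<Prod>j=0..k-1. subst_r \<kappa> (var_s ^ j))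
      - fps_X * fps_const var_s * fps_const (var_m * (var_u - 1) + 1)
          * (\<Prod>j=0..k. subst_r \<kappa> (var_s ^ j))"
  shows "(\<lambda>n. (- (fps_X * fps_const var_s)) ^ n
           * fps_const (\<Sum>\<mu>\<in>Dyck n k.
               var_s ^ card (Y_boxes (lowest_path n k) \<mu>) * wtIII n \<mu>)) sums \<kappa>"
proof -
  let ?d = "\<lambda>n. descent_sum k var_s (var_m - 1) (var_m * (var_u - 1) + 1) n 0"
  have sets: "{0..k - 1} = {..<k}" "{0..k} = {..<Suc k}"
    using assms(1) by auto
  \<comment> \<open>Case l = 0: the product has the single factor \<kappa>, rescaled by
    \<open>s^0 = 1\<close>.\<close>
  have nth: "(\<Prod>j<Suc 0. subst_r \<kappa> (var_s ^ j)) $ n = (- var_s) ^ n * ?d n" for n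
    by (rule nth_rescaled_product[OF _ assms(2)[unfolded sets]]) (use assms(1) in simp)
  have "(- (fps_X * fps_const var_s)) ^ n * fps_const (?d n) = fps_const (\<kappa> $ n) * fps_X ^ n" for n
  proof -
    have "- (fps_X * fps_const var_s) = fps_const (- var_s) * fps_X"
      by (simp add: mult.commute flip: fps_const_neg)
    moreover have "\<kappa> $ n = (- var_s) ^ n * ?d n"
      using nth[of n] by (simp add: subst_r_nth)
    ultimately show ?thesis
      by (simp only: power_mult_distrib fps_const_power fps_const_mult[symmetric] mult_ac)
  qed
  \<comment> \<open>Each summand is the degree n monomial of \<kappa>, and the truncations of a
    power series converge to it.\<close>
  then show ?thesis
    unfolding Dyck_sum_eq_descent_sum sums_def_le
    using fps_notation[of \<kappa>] by (simp add: atMost_atLeast0)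
qed

end
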